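(* Let $\mathcal{G}$ be a DAG with vertex set $V=\{1,\dots,p\}$ whose edges are consistent with the ordering $1<\dots<p$, let $A\subseteq V$, and let $\mathcal{G}^*$ be the corresponding augmented DAG. Suppose the kernel $p(W_V\mid F_A)$ obeys distributional consistency and the augmented DAG local Markov property with respect to $\mathcal{G}^*$. Let $a\in\mathfrak{X}_A$ be an assignment to the intervention targets and let $v\in\mathfrak{X}_V$. Then for every $i\in V$: $$p(W_i=v_i\mid F_A=a,\,W_{\mathrm{pre}(i)}=v_{\mathrm{pre}(i)})=p(W_i=v_i\mid W_{\mathrm{pa}(i)\cap A}=a_{\mathrm{pa}(i)\cap A},\,W_{\mathrm{pa}(i)\setminus A}=v_{\mathrm{pa}(i)\setminus A}).$$ Consequently, provided that the conditional distributions on the right-hand side are identified by $p(W_V)$ for all $i\in V$ and $v\in\mathfrak{X}_V$, the distribution $p(W_V\mid F_A=a)$ is identified given $p(W_V)$, and it obeys the Markov property for the DAG formed from $\mathcal{G}^*$ by removing all outgoing edges from vertices in $A$.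
   Context: Variables are indexed by $V=\{1,\dots,p\}$ with discrete state spaces $\mathfrak{X}_i$; $\mathfrak{X}_D=\prod_{i\in D}\mathfrak{X}_i$ and $x_D$ is the restriction of an assignment $x$ to $D$. $A\subseteq V$ is the set of intervention targets. Each $i\in A$ has a non-stochastic regime indicator $F_i$ taking values in $\mathfrak{X}_i\cup\{\emptyset\}$, where $\emptyset$ ("idle") means no intervention. The kernel $p(W_V\mid F_A)$ assigns to each $f\in\prod_{i\in A}(\mathfrak{X}_i\cup\{\emptyset\})$ a probability distribution on $\mathfrak{X}_V$ for the random vector $W_V=(W_i)_{i\in V}$. Convention: regime indicators that are not mentioned are idle, so $p(\cdot\mid F_C=c)$ means $F_C=c$ and $F_{A\setminus C}=\emptyset$; the observed distribution $p(W_V)$ has all indicators idle. Conditional probabilities are considered when the conditioning event has positive probability, and an equality of conditional probabilities is asserted whenever both conditioning events have positive probability. Distributional consistency: for every $j\in A$, $C\subseteq A\setminus\{j\}$ (possibly empty), $c\in\mathfrak{X}_C$ and $v\in\mathfrak{X}_V$: $p(W_V=v\mid F_j=v_j,F_C=c)=p(W_V=v\mid F_C=c)$. (Equivalently $W_V\perp F_j^*\mid F_C,\,F_C\neq\emptyset$, where $F_j^*\in\{\emptyset,g_j^*\}$ and $g_j^*$ is the dynamic regime that sets the target $j$ to its natural value $W_j$.) $\mathrm{pa}(i)$ is the set of parents of $i$ in $\mathcal{G}$ and $\mathrm{pre}(i)=\{1,\dots,i-1\}$. The augmented DAG $\mathcal{G}^*$ has vertex set $V\cup\{F_i: i\in A\}$,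 the edges of $\mathcal{G}$, and an edge $F_i\to j$ whenever $i\in A$ and $i\to j$ in $\mathcal{G}$. Augmented DAG local Markov property for $\mathcal{G}^*$: for all $i\in V$, $W_i\perp F_{A\setminus \mathrm{pa}(i)},\,W_{\mathrm{pre}(i)\setminus(\mathrm{pa}(i)\setminus A)}\mid W_{\mathrm{pa}(i)\setminus A},\,F_{A\cap \mathrm{pa}(i)},\,F_A\neq\emptyset$; i.e. for $a\in\mathfrak{X}_A$ (all indicators non-idle) and $w\in\mathfrak{X}_{\mathrm{pre}(i)}$, the conditional distribution $p(W_i\mid W_{\mathrm{pre}(i)}=w,F_A=a)$ is a function only of $a_{A\cap \mathrm{pa}(i)}$ and $w_{\mathrm{pa}(i)\setminus A}$ (over pairs $(a,w)$ for which it is defined). A conditional distribution is identified by $p(W_V)$ if its conditioning event has positive probability under $p(W_V)$. $p(W_V\mid F_A=a)$ is identified given $p(W_V)$ if it is uniquely determined by $p(W_V)$: any two kernels satisfying the hypotheses with the same $p(W_V)$ and satisfying the stated identification proviso have the same $p(W_V\mid F_A=a)$. A distribution $q$ on $\mathfrak{X}_V$ obeys the Markov property for a DAG $D$ with vertices $V$ together with regime indicators if, for all disjoint $Y,Z,U\subseteq V$ such that $Y$ is d-separated from $Z$ in $D$ given $U$ and all regime indicators, $W_Y$ is conditionally independent of $W_Z$ given $W_U$ under $q$. *)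

theory Defs
  imports "HOL-Probability.Probability"
begin

(* A DAG on {1..p} is its edge relation; the state space of W_i is the set X i, and an
   assignment x_D is an element of PiE D X.  Discrete distributions are pmfs. *)

definition ordered_dag :: "nat \<Rightarrow> (nat \<times> nat) set \<Rightarrow> bool" where
  "ordered_dag p E \<longleftrightarrow>
     E \<subseteq> {1..p} \<times> {1..p} \<and> acyclic E \<and> (\<forall>(i, j)\<in>E. i < j)"

definition pa :: "(nat \<times> nat) set \<Rightarrow> nat \<Rightarrow> nat set" where
  "pa E i = {j. (j, i) \<in> E}"

definition pre :: "nat \<Rightarrow> nat set" where
  "pre i = {1..<i}"

definition agree :: "'i set \<Rightarrow> ('i \<Rightarrow> 'x) \<Rightarrow> ('i \<Rightarrow> 'x) \<Rightarrow> bool" where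
  "agree D w x \<longleftrightarrow> (\<forall>i\<in>D. w i = x i)"

(* A value f of the regime indicators is a partial map with domain contained in A, where
   f i = None says that F_i is idle; the observational regime is Map.empty. *)

definition regimes :: "(nat \<Rightarrow> 'x set) \<Rightarrow> nat set \<Rightarrow> (nat \<rightharpoonup> 'x) set" where
  "regimes X A = {f. dom f \<subseteq> A \<and> (\<forall>i\<in>A. f i \<in> insert None (Some ` X i))}"

(* The regime F_C = c; indicators that are not mentioned are idle. *)
definition do_regime :: "nat set \<Rightarrow> (nat \<Rightarrow> 'x) \<Rightarrow> (nat \<rightharpoonup> 'x)" where
  "do_regime C c = (\<lambda>i. if i \<in> C then Some (c i) else None)"

(* Values of K at maps outside regimes X A are irrelevant and left unconstrained. *)
definition intervention_kernel ::
  "nat \<Rightarrow> (nat \<Rightarrow> 'x set) \<Rightarrow> nat set \<Rightarrow> ((nat \<rightharpoonup> 'x) \<Rightarrow> (nat \<Rightarrow> 'x) pmf) \<Rightarrow> bool" where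
  "intervention_kernel p X A K \<longleftrightarrow> (\<forall>f\<in>regimes X A. set_pmf (K f) \<subseteq> PiE {1..p} X)"

definition distributional_consistency ::
  "nat \<Rightarrow> (nat \<Rightarrow> 'x set) \<Rightarrow> nat set \<Rightarrow> ((nat \<rightharpoonup> 'x) \<Rightarrow> (nat \<Rightarrow> 'x) pmf) \<Rightarrow> bool" where
  "distributional_consistency p X A K \<longleftrightarrow>
     (\<forall>j\<in>A. \<forall>C. C \<subseteq> A - {j} \<longrightarrow> (\<forall>c\<in>PiE C X. \<forall>v\<in>PiE {1..p} X.
        pmf (K ((do_regime C c)(j \<mapsto> v j))) v = pmf (K (do_regime C c)) v))"

definition augmented_local_markov ::
  "nat \<Rightarrow> (nat \<Rightarrow> 'x set) \<Rightarrow> nat set \<Rightarrow> (nat \<times> nat) set \<Rightarrow>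
     ((nat \<rightharpoonup> 'x) \<Rightarrow> (nat \<Rightarrow> 'x) pmf) \<Rightarrow> bool" where
  "augmented_local_markov p X A E K \<longleftrightarrow>
     (\<forall>i\<in>{1..p}. \<exists>k. \<forall>a\<in>PiE A X. \<forall>w\<in>PiE (pre i) X.
        \<P>(u in measure_pmf (K (do_regime A a)). agree (pre i) u w) > 0 \<longrightarrow>
        (\<forall>x\<in>X i.
           \<P>(u in measure_pmf (K (do_regime A a)). u i = x \<bar> agree (pre i) u w) =
             k (restrict a (A \<inter> pa E i)) (restrict w (pa E i - A)) x))"

definition parent_event ::
  "nat set \<Rightarrow> (nat \<times> nat) set \<Rightarrow> (nat \<Rightarrow> 'x) \<Rightarrow> (nat \<Rightarrow> 'x) \<Rightarrow> nat \<Rightarrow> (nat \<Rightarrow> 'x) \<Rightarrow> bool" where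
  "parent_event A E a v i w \<longleftrightarrow> agree (pa E i \<inter> A) w a \<and> agree (pa E i - A) w v"

definition cond_dists_identified ::
  "nat \<Rightarrow> (nat \<Rightarrow> 'x set) \<Rightarrow> nat set \<Rightarrow> (nat \<times> nat) set \<Rightarrow> (nat \<Rightarrow> 'x) \<Rightarrow>
     (nat \<Rightarrow> 'x) pmf \<Rightarrow> bool" where
  "cond_dists_identified p X A E a q \<longleftrightarrow>
     (\<forall>i\<in>{1..p}. \<forall>v\<in>PiE {1..p} X. \<P>(w in measure_pmf q. parent_event A E a v i w) > 0)"

datatype vertex = Var nat | Reg nat

definition augmented_dag :: "nat set \<Rightarrow> (nat \<times> nat) set \<Rightarrow> (vertex \<times> vertex) set" where
  "augmented_dag A E =
     {(Var i, Var j) | i j. (i, j) \<in> E} \<union> {(Reg i, Var j) | i j. i \<in> A \<and> (i, j) \<in> E}"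

definition remove_outgoing :: "'n set \<Rightarrow> ('n \<times> 'n) set \<Rightarrow> ('n \<times> 'n) set" where
  "remove_outgoing B D = {(x, y) \<in> D. x \<notin> B}"

definition graph_path :: "('n \<times> 'n) set \<Rightarrow> 'n list \<Rightarrow> bool" where
  "graph_path D xs \<longleftrightarrow> xs \<noteq> [] \<and> distinct xs \<and>
     (\<forall>k. Suc k < length xs \<longrightarrow>
        (xs ! k, xs ! Suc k) \<in> D \<or> (xs ! Suc k, xs ! k) \<in> D)"

definition collider :: "('n \<times> 'n) set \<Rightarrow> 'n list \<Rightarrow> nat \<Rightarrow> bool" where
  "collider D xs k \<longleftrightarrow> (xs ! (k - 1), xs ! k) \<in> D \<and> (xs ! Suc k, xs ! k) \<in> D"

definition blocked :: "('n \<times> 'n) set \<Rightarrow> 'n set \<Rightarrow> 'n list \<Rightarrow> bool" where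
  "blocked D S xs \<longleftrightarrow>
     (\<exists>k. 0 < k \<and> Suc k < length xs \<and>
        (if collider D xs k then \<forall>s\<in>S. (xs ! k, s) \<notin> D\<^sup>* else xs ! k \<in> S))"

definition d_separated :: "('n \<times> 'n) set \<Rightarrow> 'n set \<Rightarrow> 'n set \<Rightarrow> 'n set \<Rightarrow> bool" where
  "d_separated D Y Z S \<longleftrightarrow>
     (\<forall>xs. graph_path D xs \<and> hd xs \<in> Y \<and> last xs \<in> Z \<longrightarrow> blocked D S xs)"

definition cond_indep ::
  "(nat \<Rightarrow> 'x set) \<Rightarrow> (nat \<Rightarrow> 'x) pmf \<Rightarrow> nat set \<Rightarrow> nat set \<Rightarrow> nat set \<Rightarrow> bool" where
  "cond_indep X q Y Z U \<longleftrightarrow>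
     (\<forall>y\<in>PiE Y X. \<forall>z\<in>PiE Z X. \<forall>u\<in>PiE U X.
        \<P>(w in measure_pmf q. agree U w u) > 0 \<longrightarrow>
        \<P>(w in measure_pmf q. agree Y w y \<and> agree Z w z \<bar> agree U w u) =
          \<P>(w in measure_pmf q. agree Y w y \<bar> agree U w u) *
          \<P>(w in measure_pmf q. agree Z w z \<bar> agree U w u))"

definition markov_property ::
  "nat \<Rightarrow> (nat \<Rightarrow> 'x set) \<Rightarrow> nat set \<Rightarrow> (vertex \<times> vertex) set \<Rightarrow> (nat \<Rightarrow> 'x) pmf \<Rightarrow> bool" where
  "markov_property p X A D q \<longleftrightarrow>
     (\<forall>Y Z U. Y \<subseteq> {1..p} \<and> Z \<subseteq> {1..p} \<and> U \<subseteq> {1..p} \<and>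
        Y \<inter> Z = {} \<and> Y \<inter> U = {} \<and> Z \<inter> U = {} \<and>
        d_separated D (Var ` Y) (Var ` Z) (Var ` U \<union> Reg ` A) \<longrightarrow> cond_indep X q Y Z U)"

end

theory Submission
  imports Defs
begin

text \<open>Distributional consistency, used one target at a time, gives
  \<open>p(W = w) = p(W = w | F_A = w_A)\<close>. By the local Markov property \<open>p(W_1,\<dots>,W_n | F_A = a)\<close>
  depends only on the values of \<open>a\<close> at targets before \<open>n\<close>, so summing out \<open>W_p,\<dots>,W_{n+1}\<close> turns
  this identity into one for the marginal of the first \<open>n\<close> variables. Summing
  \<open>p(W_i | W_pre(i), F_A) p(W_pre(i) | F_A)\<close> over the non-parents then yields the first claim,
  and the chain rule gives identification. Under \<open>F_A = a\<close> each \<open>W_i\<close> is independent of its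
  predecessors given its non-target parents, from which d-separation is shown to be sound by
  induction on the ordering.\<close>

section \<open>Marginals and conditional independence\<close>

text \<open>The assignment \<open>w\<close> is a total function read only on \<open>S\<close>, so
  one \<open>w\<close> serves marginals over many index sets. No membership in a product space is
  demanded; \<open>marg_eq_0_outside\<close> covers the remaining assignments.\<close>

definition marg :: "('i \<Rightarrow> 'x) pmf \<Rightarrow> 'i set \<Rightarrow> ('i \<Rightarrow> 'x) \<Rightarrow> real" where
  "marg q S w = measure_pmf.prob q {u. agree S u w}"

lemma agree_Un: "agree (S \<union> T) u w \<longleftrightarrow> agree S u w \<and> agree T u w"
  by (auto simp: agree_def)

lemma agree_subset: "agree T u w \<Longrightarrow> S \<subseteq> T \<Longrightarrow> agree S u w"
  by (auto simp: agree_def)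

lemma marg_nonneg [simp]: "0 \<le> marg q S w"
  by (simp add: marg_def)

lemma marg_empty [simp]: "marg q {} w = 1"
  by (simp add: marg_def agree_def)

lemma marg_cong: "agree S w w' \<Longrightarrow> marg q S w = marg q S w'"
  unfolding marg_def by (rule arg_cong[where f = "measure_pmf.prob q"]) (auto simp: agree_def)

lemma marg_mono: "S \<subseteq> T \<Longrightarrow> marg q T w \<le> marg q S w"
  unfolding marg_def by (rule measure_pmf.finite_measure_mono) (auto simp: agree_def)

lemma marg_eq_0_mono: "marg q S w = 0 \<Longrightarrow> S \<subseteq> T \<Longrightarrow> marg q T w = 0"
  using marg_mono[of S T q w] marg_nonneg[of q T w] by linarith

lemma marg_eq_0_outside:
  assumes "set_pmf q \<subseteq> PiE V X" "i \<in> S" "i \<in> V" "w i \<notin> X i"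
  shows "marg q S w = 0"
proof -
  have "\<not> agree S u w" if "u \<in> set_pmf q" for u
  proof -
    have "u i \<in> X i" using that assms(1,3) by (blast intro: PiE_mem)
    then show ?thesis using assms(2,4) unfolding agree_def by metis
  qed
  then show ?thesis by (auto simp: marg_def measure_pmf_zero_iff)
qed

text \<open>The support consists of extensional functions on \<open>V\<close>, so agreement on
  \<open>V\<close> determines the outcome.\<close>

lemma marg_full:
  assumes "set_pmf q \<subseteq> PiE V X" "w \<in> PiE V X"
  shows "marg q V w = pmf q w"
proof -
  have "u = w" if "u \<in> set_pmf q" "agree V u w" for u
    by (rule PiE_ext[of u V X w]) (use that assms in \<open>auto simp: agree_def\<close>)
  then have "AE u in measure_pmf q. u \<in> {u. agree V u w} \<longleftrightarrow> u \<in> {w}"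
    by (auto simp: AE_measure_pmf_iff agree_def)
  then have "measure_pmf.prob q {u. agree V u w} = measure_pmf.prob q {w}"
    by (intro measure_pmf.finite_measure_eq_AE) auto
  then show ?thesis by (simp add: marg_def measure_pmf_single)
qed

text \<open>A pmf has countable support, so countably many slices suffice even when the state spaces
  are uncountable. \<open>C\<close> may exceed the support, which lets two pmfs share one index
  set.\<close>

lemma emeasure_agree_partition:
  assumes "W \<inter> S = {}" "set_pmf q \<subseteq> C" "countable C"
  shows "emeasure (measure_pmf q) {u. agree S u w} =
    (\<integral>\<^sup>+b. emeasure (measure_pmf q) {u. agree S u w \<and> restrict u W = b}
      \<partial>count_space ((\<lambda>u. restrict u W) ` C))"
proof -
  let ?I = "(\<lambda>u. restrict u W) ` C"
  have "emeasure (measure_pmf q) {u. agree S u w} =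
      emeasure (measure_pmf q) (\<Union>b\<in>?I. {u. agree S u w \<and> restrict u W = b})"
    using assms(2) by (intro emeasure_eq_AE) (auto simp: AE_measure_pmf_iff)
  also have "\<dots> = (\<integral>\<^sup>+b. emeasure (measure_pmf q) {u. agree S u w \<and> restrict u W = b}
      \<partial>count_space ?I)"
    using assms(3) by (intro emeasure_UN_countable) (auto simp: disjoint_family_on_def)
  finally show ?thesis .
qed

text \<open>All summation over variables passes through this lemma. The coefficients do not depend
  on the coordinates in \<open>W\<close>, so the identity can be added up over the slices; extended
  nonnegative sums avoid any summability question.\<close>

lemma marg_sum_out:
  assumes disj: "W \<inter> S1 = {}" "W \<inter> S2 = {}"
    and c: "0 \<le> c1" "0 \<le> c2"
    and eq: "\<And>w'. agree (- W) w' w \<Longrightarrow> c1 * marg q1 (S1 \<union> W) w' = c2 * marg q2 (S2 \<union> W) w'"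
  shows "c1 * marg q1 S1 w = c2 * marg q2 S2 w"
proof -
  let ?C = "set_pmf q1 \<union> set_pmf q2"
  let ?I = "(\<lambda>u. restrict u W) ` ?C"
  let ?m = "\<lambda>q S b. emeasure (measure_pmf q) {u. agree S u w \<and> restrict u W = b}"
  \<comment> \<open>A slice is again a marginal, taken at \<open>w\<close> overwritten on
    \<open>W\<close> by a representative \<open>u0\<close>.\<close>
  have slice: "?m q S (restrict u0 W) = ennreal (marg q (S \<union> W) (override_on w u0 W))"
    if "W \<inter> S = {}" for q S u0
  proof -
    have "{u. agree S u w \<and> restrict u W = restrict u0 W} =
        {u. agree (S \<union> W) u (override_on w u0 W)}"
    proof (rule Collect_cong)
      fix u
      have "restrict u W = restrict u0 W \<longleftrightarrow> (\<forall>i\<in>W. u i = u0 i)"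
        by (auto simp: restrict_def fun_eq_iff)
      moreover have "agree S u (override_on w u0 W) \<longleftrightarrow> agree S u w"
        using that by (auto simp: agree_def override_on_def)
      ultimately show "agree S u w \<and> restrict u W = restrict u0 W \<longleftrightarrow>
          agree (S \<union> W) u (override_on w u0 W)"
        by (auto simp: agree_Un) (auto simp: agree_def)
    qed
    then show ?thesis by (simp add: marg_def measure_pmf.emeasure_eq_measure)
  qed
  have *: "ennreal c1 * ?m q1 S1 b = ennreal c2 * ?m q2 S2 b" if "b \<in> ?I" for b
  proof -
    from that obtain u0 where b: "b = restrict u0 W" by auto
    have "agree (- W) (override_on w u0 W) w" by (auto simp: agree_def)
    from eq[OF this] show ?thesis
      using c disj by (simp add: b slice ennreal_mult[symmetric])
  qed
  have "ennreal c1 * emeasure (measure_pmf q1) {u. agree S1 u w} =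
      (\<integral>\<^sup>+b. ennreal c1 * ?m q1 S1 b \<partial>count_space ?I)"
    using disj by (subst emeasure_agree_partition[of W S1 q1 ?C])
      (auto intro!: nn_integral_cmult[symmetric] simp: countable_Un)
  also have "\<dots> = (\<integral>\<^sup>+b. ennreal c2 * ?m q2 S2 b \<partial>count_space ?I)"
    using * by (intro nn_integral_cong) (simp add: space_count_space)
  also have "\<dots> = ennreal c2 * emeasure (measure_pmf q2) {u. agree S2 u w}"
    using disj by (subst emeasure_agree_partition[of W S2 q2 ?C])
      (auto intro!: nn_integral_cmult simp: countable_Un)
  finally show ?thesis
    using c by (simp add: marg_def measure_pmf.emeasure_eq_measure ennreal_mult[symmetric])
qed

text \<open>Conditional independence multiplied out: no division and no positivity condition, so the
  graphoid rules below need no hypothesis of strictly positive probabilities.\<close>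

definition ci :: "('i \<Rightarrow> 'x) pmf \<Rightarrow> 'i set \<Rightarrow> 'i set \<Rightarrow> 'i set \<Rightarrow> bool" where
  "ci q Y Z U \<longleftrightarrow>
     (\<forall>w. marg q (Y \<union> Z \<union> U) w * marg q U w = marg q (Y \<union> U) w * marg q (Z \<union> U) w)"

lemma ci_sym: "ci q Y Z U \<Longrightarrow> ci q Z Y U"
  by (simp add: ci_def Un_commute mult.commute)

lemma ci_decomposition:
  assumes "ci q Y (Z \<union> W) U" "W \<inter> (Y \<union> Z \<union> U) = {}"
  shows "ci q Y Z U"
  unfolding ci_def
proof
  fix w
  have "marg q U w * marg q (Y \<union> Z \<union> U) w = marg q (Y \<union> U) w * marg q (Z \<union> U) w"
  proof (rule marg_sum_out[where W = W])
    fix w' assume w': "agree (- W) w' w"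
    have "marg q U w' = marg q U w" "marg q (Y \<union> U) w' = marg q (Y \<union> U) w"
      using assms(2) by (auto intro!: marg_cong agree_subset[OF w'])
    moreover have "marg q (Y \<union> (Z \<union> W) \<union> U) w' * marg q U w' =
        marg q (Y \<union> U) w' * marg q (Z \<union> W \<union> U) w'"
      using assms(1) unfolding ci_def by blast
    ultimately show "marg q U w * marg q (Y \<union> Z \<union> U \<union> W) w' =
        marg q (Y \<union> U) w * marg q (Z \<union> U \<union> W) w'"
      by (simp add: ac_simps)
  qed (use assms(2) in auto)
  then show "marg q (Y \<union> Z \<union> U) w * marg q U w = marg q (Y \<union> U) w * marg q (Z \<union> U) w"
    by (simp add: mult.commute)
qed

text \<open>Multiply the hypothesis by its decomposition to \<open>W\<close> and cancel the marginal
  of \<open>U\<close>. Where that marginal is zero, both sides vanish by monotonicity.\<close>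

lemma ci_weak_union:
  assumes "ci q Y (Z \<union> W) U" "Z \<inter> (Y \<union> W \<union> U) = {}"
  shows "ci q Y Z (U \<union> W)"
  unfolding ci_def
proof
  fix w
  have 1: "marg q (Y \<union> Z \<union> (U \<union> W)) w * marg q U w = marg q (Y \<union> U) w * marg q (Z \<union> (U \<union> W)) w"
    using assms(1) unfolding ci_def by (simp add: ac_simps)
  have "ci q Y W U"
    using assms by (intro ci_decomposition[of q Y W Z]) (auto simp: Un_commute)
  then have 2: "marg q (Y \<union> (U \<union> W)) w * marg q U w = marg q (Y \<union> U) w * marg q (U \<union> W) w"
    unfolding ci_def by (simp add: ac_simps)
  show "marg q (Y \<union> Z \<union> (U \<union> W)) w * marg q (U \<union> W) w =
      marg q (Y \<union> (U \<union> W)) w * marg q (Z \<union> (U \<union> W)) w"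
  proof (cases "marg q U w = 0")
    case True
    then have "marg q (U \<union> W) w = 0" "marg q (Z \<union> (U \<union> W)) w = 0"
      by (auto elim: marg_eq_0_mono)
    then show ?thesis by simp
  next
    case False
    have "(marg q (Y \<union> Z \<union> (U \<union> W)) w * marg q (U \<union> W) w) * marg q U w =
        (marg q (Y \<union> (U \<union> W)) w * marg q (Z \<union> (U \<union> W)) w) * marg q U w"
      using 1 2 by algebra
    with False show ?thesis by simp
  qed
qed

text \<open>The two hypotheses multiply to the claim times the marginal of
  \<open>Z \<union> U\<close>, which cancels unless it is zero; then both sides are zero.\<close>

lemma ci_contraction:
  assumes "ci q Y Z U" "ci q Y W (Z \<union> U)"
  shows "ci q Y (Z \<union> W) U"
  unfolding ci_def
proof
  fix w
  have 1: "marg q (Y \<union> (Z \<union> W) \<union> U) w * marg q (Z \<union> U) w =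
      marg q (Y \<union> Z \<union> U) w * marg q (Z \<union> W \<union> U) w"
    using assms(2) unfolding ci_def by (simp add: ac_simps)
  have 2: "marg q (Y \<union> Z \<union> U) w * marg q U w = marg q (Y \<union> U) w * marg q (Z \<union> U) w"
    using assms(1) unfolding ci_def by blast
  show "marg q (Y \<union> (Z \<union> W) \<union> U) w * marg q U w = marg q (Y \<union> U) w * marg q (Z \<union> W \<union> U) w"
  proof (cases "marg q (Z \<union> U) w = 0")
    case True
    then have "marg q (Y \<union> (Z \<union> W) \<union> U) w = 0" "marg q (Z \<union> W \<union> U) w = 0"
      by (auto elim: marg_eq_0_mono)
    then show ?thesis by simp
  next
    case False
    have "(marg q (Y \<union> (Z \<union> W) \<union> U) w * marg q U w) * marg q (Z \<union> U) w =
        (marg q (Y \<union> U) w * marg q (Z \<union> W \<union> U) w) * marg q (Z \<union> U) w"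
      using 1 2 by algebra
    with False show ?thesis by simp
  qed
qed

lemma cond_prob_eq_marg:
  "\<P>(u in measure_pmf q. agree S u w \<bar> agree T u w) = marg q (S \<union> T) w / marg q T w"
  by (simp add: cond_prob_def marg_def agree_Un)

lemma ci_imp_cond_indep:
  assumes "ci q Y Z U" "Y \<inter> Z = {}" "Y \<inter> U = {}" "Z \<inter> U = {}"
  shows "cond_indep X q Y Z U"
  unfolding cond_indep_def
proof (intro ballI impI)
  fix y z u
  assume pos: "\<P>(w in measure_pmf q. agree U w u) > 0"
  \<comment> \<open>Disjointness allows the three partial assignments to be glued into one.\<close>
  define w where "w = override_on (override_on u z Z) y Y"
  have "agree Y v y \<longleftrightarrow> agree Y v w" "agree Z v z \<longleftrightarrow> agree Z v w"
    "agree U v u \<longleftrightarrow> agree U v w" for v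
    using assms(2-4) by (auto simp: agree_def w_def override_on_def)
  note eqs = this
  have "marg q U w > 0" using pos by (simp add: eqs marg_def)
  moreover have "marg q (Y \<union> Z \<union> U) w * marg q U w = marg q (Y \<union> U) w * marg q (Z \<union> U) w"
    using assms(1) unfolding ci_def by blast
  ultimately show "\<P>(w in measure_pmf q. agree Y w y \<and> agree Z w z \<bar> agree U w u) =
      \<P>(w in measure_pmf q. agree Y w y \<bar> agree U w u) *
      \<P>(w in measure_pmf q. agree Z w z \<bar> agree U w u)"
    unfolding eqs agree_Un[symmetric] cond_prob_eq_marg by (simp add: field_simps)
qed

section \<open>Active walks\<close>

text \<open>The negation of the blocking condition at one interior vertex, expressed by its
  neighbours instead of a list position, so that lists can be cut and joined.\<close>

definition open_at :: "('n \<times> 'n) set \<Rightarrow> 'n set \<Rightarrow> 'n \<Rightarrow> 'n \<Rightarrow> 'n \<Rightarrow> bool" where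
  "open_at D S x y z \<longleftrightarrow>
     (if (x, y) \<in> D \<and> (z, y) \<in> D then \<exists>s\<in>S. (y, s) \<in> D\<^sup>* else y \<notin> S)"

text \<open>Vertices may repeat. Walks, unlike paths, can be concatenated freely;
  \<open>active_walk_to_path\<close> removes repetitions afterwards.\<close>

fun active :: "('n \<times> 'n) set \<Rightarrow> 'n set \<Rightarrow> 'n list \<Rightarrow> bool" where
  "active D S (x # y # z # zs) \<longleftrightarrow>
     ((x, y) \<in> D \<or> (y, x) \<in> D) \<and> open_at D S x y z \<and> active D S (y # z # zs)"
| "active D S [x, y] \<longleftrightarrow> (x, y) \<in> D \<or> (y, x) \<in> D"
| "active D S xs \<longleftrightarrow> True"

lemma open_at_sym: "open_at D S x y z \<longleftrightarrow> open_at D S z y x"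
  by (auto simp: open_at_def)

lemma active_append:
  "active D S (xs @ v # ys) \<longleftrightarrow> active D S (xs @ [v]) \<and> active D S (v # ys) \<and>
     (xs \<noteq> [] \<longrightarrow> ys \<noteq> [] \<longrightarrow> open_at D S (last xs) v (hd ys))"
proof (induction xs)
  case (Cons x xs)
  show ?case
  proof (cases xs)
    case Nil
    then show ?thesis by (cases ys) auto
  next
    case (Cons x' xs')
    then show ?thesis
      using \<open>active D S (xs @ v # ys) \<longleftrightarrow> _\<close> by (cases xs') (auto)
  qed
qed simp

lemma active_rev: "active D S (rev xs) \<longleftrightarrow> active D S xs"
proof (induction D S xs rule: active.induct)
  case (1 D S x y z zs)
  have "active D S (rev (x # y # z # zs)) \<longleftrightarrow> active D S ((rev zs @ [z]) @ y # [x])" by simp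
  also have "\<dots> \<longleftrightarrow> active D S (x # y # z # zs)"
    using 1 by (subst active_append) (auto simp: open_at_sym)
  finally show ?case .
qed auto

lemma active_nth:
  assumes "active D S xs" "Suc k < length xs"
  shows "(xs ! k, xs ! Suc k) \<in> D \<or> (xs ! Suc k, xs ! k) \<in> D"
    and "0 < k \<Longrightarrow> open_at D S (xs ! (k - 1)) (xs ! k) (xs ! Suc k)"
proof -
  have "((xs ! k, xs ! Suc k) \<in> D \<or> (xs ! Suc k, xs ! k) \<in> D) \<and>
      (0 < k \<longrightarrow> open_at D S (xs ! (k - 1)) (xs ! k) (xs ! Suc k))"
    using assms
  proof (induction D S xs arbitrary: k rule: active.induct)
    case (1 D S x y z zs)
    show ?case
    proof (cases k)
      case (Suc k')
      then show ?thesis using 1(1)[of k'] 1(2,3) by (cases k') simp_all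
    qed (use 1 in simp)
  qed auto
  then show "(xs ! k, xs ! Suc k) \<in> D \<or> (xs ! Suc k, xs ! k) \<in> D"
    and "0 < k \<Longrightarrow> open_at D S (xs ! (k - 1)) (xs ! k) (xs ! Suc k)" by auto
qed

text \<open>Follow the edges forward from \<open>x\<close>. Either they stay forward up to the last
  vertex, or the first reversal is an open collider, whose descendant in \<open>S\<close> also
  descends from \<open>x\<close>.\<close>

lemma active_forward:
  assumes "active D S (x # y # ys)" "(x, y) \<in> D"
  shows "(\<exists>s\<in>S. (x, s) \<in> D\<^sup>*) \<or> (x, last (y # ys)) \<in> D\<^sup>+"
  using assms
proof (induction ys arbitrary: x y)
  case (Cons z zs)
  show ?case
  proof (cases "(z, y) \<in> D")
    case True
    with Cons.prems obtain s where "s \<in> S" "(y, s) \<in> D\<^sup>*" by (auto simp: open_at_def)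
    with Cons.prems(2) show ?thesis by (meson converse_rtrancl_into_rtrancl)
  next
    case False
    with Cons.prems have "active D S (y # z # zs)" "(y, z) \<in> D" by (cases zs; auto)+
    from Cons.IH[OF this] Cons.prems(2) show ?thesis
      by (auto intro: converse_rtrancl_into_rtrancl trancl_into_trancl2)
  qed
qed auto

text \<open>Only the new triple at \<open>v\<close> needs checking. If it is a non-collider, one of
  the two old triples at \<open>v\<close> was one as well, so \<open>v\<close> is outside
  \<open>S\<close>. If it is a collider, look at the first edge of the loop: pointing into
  \<open>v\<close>, it made the left triple an open collider; leaving \<open>v\<close>, it cannot
  lead forward back to \<open>v\<close> by acyclicity, so \<open>active_forward\<close> gives a
  descendant in \<open>S\<close>.\<close>

lemma active_splice:
  assumes "acyclic D" "active D S (xs @ v # ys @ v # zs)"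
  shows "active D S (xs @ v # zs)"
proof -
  have left: "active D S (xs @ [v])" "active D S (v # ys @ v # zs)"
    and open_left: "xs \<noteq> [] \<Longrightarrow> open_at D S (last xs) v (hd (ys @ v # zs))"
    using assms(2) unfolding active_append[of D S xs v "ys @ v # zs"] by auto
  have right: "active D S (v # ys @ [v])" "active D S (v # zs)"
    and open_right: "zs \<noteq> [] \<Longrightarrow> open_at D S (last (v # ys)) v (hd zs)"
    using left(2) active_append[of D S "v # ys" v zs] by auto
  have "open_at D S (last xs) v (hd zs)" if "xs \<noteq> []" "zs \<noteq> []"
  proof (cases "(last xs, v) \<in> D \<and> (hd zs, v) \<in> D")
    case True
    show ?thesis
    proof (cases "(v, hd (ys @ [v])) \<in> D")
      case forward: True
      obtain y ys' where ys: "ys @ [v] = y # ys'" by (cases "ys @ [v]") auto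
      have "(\<exists>s\<in>S. (v, s) \<in> D\<^sup>*) \<or> (v, last (y # ys')) \<in> D\<^sup>+"
        using active_forward[of D S v y ys'] right(1) forward ys by simp
      moreover have "last (y # ys') = v" by (metis last_snoc ys)
      ultimately show ?thesis using assms(1) True by (auto simp: open_at_def acyclic_def)
    next
      case False
      have "(v, hd (ys @ [v])) \<in> D \<or> (hd (ys @ [v]), v) \<in> D"
        using active_nth(1)[OF right(1), of 0] by (cases ys) auto
      moreover have "hd (ys @ v # zs) = hd (ys @ [v])" by (cases ys) auto
      ultimately show ?thesis
        using False open_left[OF that(1)] True by (auto simp: open_at_def)
    qed
  next
    case False
    then show ?thesis
      using open_left[OF that(1)] open_right[OF that(2)] by (auto simp: open_at_def split: if_splits)
  qed
  then show ?thesis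
    using left right by (subst active_append) auto
qed

lemma active_walk_to_path:
  assumes "acyclic D" "active D S xs" "xs \<noteq> []"
  shows "\<exists>ys. ys \<noteq> [] \<and> distinct ys \<and> hd ys = hd xs \<and> last ys = last xs \<and> active D S ys"
  using assms(2,3)
proof (induction "length xs" arbitrary: xs rule: less_induct)
  case less
  show ?case
  proof (cases "distinct xs")
    case False
    then obtain as bs cs v where xs: "xs = as @ v # bs @ v # cs"
      using not_distinct_decomp[of xs] by auto
    have "active D S (as @ v # cs)"
      using active_splice[OF assms(1)] less.prems(1) unfolding xs .
    moreover have "hd (as @ v # cs) = hd xs" "last (as @ v # cs) = last xs"
      unfolding xs by (cases as; simp)+
    ultimately show ?thesis using less.hyps[of "as @ v # cs"] xs by force
  qed (use less in blast)
qed

section \<open>Soundness of d-separation for ordered DAGs\<close>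

definition connected_given :: "('n \<times> 'n) set \<Rightarrow> 'n set \<Rightarrow> 'n set \<Rightarrow> 'n set \<Rightarrow> bool" where
  "connected_given D S Y Z \<longleftrightarrow>
     (\<exists>xs. xs \<noteq> [] \<and> hd xs \<in> Y \<and> last xs \<in> Z \<and> active D S xs)"

lemma connected_given_sym: "connected_given D S Y Z \<Longrightarrow> connected_given D S Z Y"
  unfolding connected_given_def
proof (elim exE conjE)
  fix xs assume "xs \<noteq> []" "hd xs \<in> Y" "last xs \<in> Z" "active D S xs"
  then show "\<exists>xs. xs \<noteq> [] \<and> hd xs \<in> Z \<and> last xs \<in> Y \<and> active D S xs"
    by (intro exI[of _ "rev xs"]) (simp add: hd_rev last_rev active_rev)
qed

lemma connected_given_Un:
  "connected_given D S Y (Z \<union> W) \<longleftrightarrow> connected_given D S Y Z \<or> connected_given D S Y W"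
  unfolding connected_given_def
  by (simp add: conj_disj_distribL conj_disj_distribR ex_disj_distrib)

text \<open>A single vertex is an active walk.\<close>

lemma disjoint_if_not_connected_given: "\<not> connected_given D S Y Z \<Longrightarrow> Y \<inter> Z = {}"
  unfolding connected_given_def by (force dest: spec[of _ "[_]"])

text \<open>A vertex of maximal index on a walk is a collider, so it cannot be larger than all
  vertices of the conditioning set.\<close>

lemma active_le:
  fixes D :: "(nat \<times> nat) set"
  assumes ord: "\<And>i j. (i, j) \<in> D \<Longrightarrow> i < j"
    and "active D S xs" "xs \<noteq> []" "hd xs \<le> n" "last xs \<le> n" "\<And>s. s \<in> S \<Longrightarrow> s \<le> n"
  shows "x \<in> set xs \<Longrightarrow> x \<le> n"
proof -
  define m where "m = Max (set xs)"
  have m: "m \<in> set xs" "\<And>y. y \<in> set xs \<Longrightarrow> y \<le> m"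
    using assms(3) by (auto simp: m_def)
  have le_star: "(x, y) \<in> D\<^sup>* \<Longrightarrow> x \<le> y" for x y
    by (induction rule: rtrancl_induct) (auto dest: ord)
  have "m \<le> n"
  proof (rule ccontr)
    assume "\<not> m \<le> n"
    obtain k where k: "k < length xs" "xs ! k = m" using m(1) by (auto simp: in_set_conv_nth)
    have "k \<noteq> 0" using k \<open>\<not> m \<le> n\<close> assms(3,4) by (cases k) (auto simp: hd_conv_nth)
    have "Suc k \<noteq> length xs" using k(2) \<open>\<not> m \<le> n\<close> assms(3,5)
      by (metis diff_Suc_1 last_conv_nth)
    with k have k': "Suc k < length xs" by simp
    have "(xs ! (k - 1), m) \<in> D"
      using active_nth(1)[OF assms(2), of "k - 1"] k \<open>k \<noteq> 0\<close> m(2)[of "xs ! (k - 1)"]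
        ord[of m "xs ! (k - 1)"] by auto
    moreover have "(xs ! Suc k, m) \<in> D"
      using active_nth(1)[OF assms(2) k'] k k' m(2)[of "xs ! Suc k"]
        ord[of m "xs ! Suc k"] by auto
    \<comment> \<open>An open collider at \<open>m\<close> has a descendant in \<open>S\<close>;
      edges increase the index, so this descendant exceeds \<open>n\<close> as well.\<close>
    ultimately obtain s where "s \<in> S" "(m, s) \<in> D\<^sup>*"
      using active_nth(2)[OF assms(2) k'] k \<open>k \<noteq> 0\<close> by (auto simp: open_at_def)
    then show False using le_star[of m s] assms(6)[of s] \<open>\<not> m \<le> n\<close> by simp
  qed
  then show "x \<in> set xs \<Longrightarrow> x \<le> n" using m(2) by force
qed

text \<open>Enlarging the conditioning set by \<open>n\<close> can close a walk only at a
  non-collider equal to \<open>n\<close>; colliders stay open.\<close>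

lemma active_insert:
  assumes "active D S xs" "n \<notin> set xs"
  shows "active D (insert n S) xs"
proof -
  have "open_at D (insert n S) x y z" if "open_at D S x y z" "y \<noteq> n" for x y z
    using that by (auto simp: open_at_def split: if_splits)
  then show ?thesis
    using assms by (induction D S xs rule: active.induct) auto
qed

text \<open>The induction removes the last vertex of the ordering. If it belongs to \<open>Y\<close>, then an
  active walk from \<open>Z\<close> to one of its parents would extend to it; if it belongs to the
  conditioning set, then it is an open collider between any two of its parents, so one of
  \<open>Y\<close>, \<open>Z\<close> is separated from the unconditioned parents.\<close>

lemma ci_if_not_connected_given:
  fixes D :: "(nat \<times> nat) set"
  assumes ord: "\<And>i j. (i, j) \<in> D \<Longrightarrow> i < j"
    and range: "D \<subseteq> {1..p} \<times> {1..p}"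
    and loc: "\<And>i. i \<in> {1..p} \<Longrightarrow> ci q {i} (pre i - pa D i) (pa D i)"
  shows "n \<le> p \<Longrightarrow> Y \<subseteq> {1..n} \<Longrightarrow> Z \<subseteq> {1..n} \<Longrightarrow> U \<subseteq> {1..n} \<Longrightarrow>
    Y \<inter> Z = {} \<Longrightarrow> Y \<inter> U = {} \<Longrightarrow> Z \<inter> U = {} \<Longrightarrow> \<not> connected_given D U Y Z \<Longrightarrow> ci q Y Z U"
proof (induction n arbitrary: Y Z U)
  case 0
  then show ?case by (simp add: ci_def)
next
  case (Suc n)
  let ?n = "Suc n"
  let ?P = "pa D ?n"
  have P: "?P \<subseteq> {1..n}" using ord range by (fastforce simp: pa_def)
  have pre_n: "pre ?n = {1..n}" by (auto simp: pre_def)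
  \<comment> \<open>Decomposition discards the predecessors outside \<open>T\<close>,
    \<open>R\<close> and the parents; weak union then moves \<open>R\<close> into the
    condition.\<close>
  have local_n: "ci q {?n} T (R \<union> ?P)" if "T \<subseteq> {1..n}" "R \<subseteq> {1..n}" "T \<inter> (R \<union> ?P) = {}" for T R
  proof -
    have "ci q {?n} ((T \<union> (R - ?P)) \<union> ({1..n} - ?P - T - R)) ?P"
    proof -
      have "(T \<union> (R - ?P)) \<union> ({1..n} - ?P - T - R) = pre ?n - ?P" using that pre_n by auto
      then show ?thesis using loc[of ?n] Suc.prems(1) by simp
    qed
    then have "ci q {?n} (T \<union> (R - ?P)) ?P"
      by (rule ci_decomposition) (use that P in auto)
    then have "ci q {?n} T (?P \<union> (R - ?P))"
      by (rule ci_weak_union) (use that in auto)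
    then show ?thesis by (simp add: Un_commute)
  qed
  \<comment> \<open>The unconditioned parents \<open>Q\<close> join \<open>Y'\<close>. The induction
    hypothesis separates \<open>Z\<close> from both, contraction adds the last vertex, whose parents
    are now all in the condition, and decomposition drops \<open>Q\<close>.\<close>
  have case_Y: "ci q Z Y U"
    if Y: "?n \<in> Y" "Y \<subseteq> {1..?n}" and ZU: "Z \<subseteq> {1..n}" "U \<subseteq> {1..n}" "Y \<inter> Z = {}" "Y \<inter> U = {}"
      "Z \<inter> U = {}" and sep: "\<not> connected_given D U Z Y" for Y Z U
  proof -
    define Y' where "Y' = Y - {?n}"
    define Q where "Q = ?P - U"
    have Y': "Y' \<subseteq> {1..n}" "Y = insert ?n Y'" "?n \<notin> Y'" using Y by (auto simp: Y'_def)
    have Q: "Q \<subseteq> {1..n}" using P by (auto simp: Q_def)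
    have "\<not> connected_given D U Z Q"
    proof
      assume "connected_given D U Z Q"
      then obtain xs where xs: "xs \<noteq> []" "hd xs \<in> Z" "last xs \<in> Q" "active D U xs"
        unfolding connected_given_def by blast
      have "(last xs, ?n) \<in> D" "last xs \<notin> U" using xs(3) by (auto simp: Q_def pa_def)
      moreover have "(?n, last xs) \<notin> D" using ord[OF \<open>(last xs, ?n) \<in> D\<close>] ord[of ?n "last xs"] by auto
      \<comment> \<open>The old endpoint now has an outgoing edge to the last vertex, hence is a
        non-collider, and it lies outside \<open>U\<close>.\<close>
      ultimately have "active D U (butlast xs @ last xs # [?n])"
        using xs(1,4) by (subst active_append) (auto simp: open_at_def)
      moreover have "butlast xs @ last xs # [?n] = xs @ [?n]" using xs(1)
        by (metis append.assoc append_Cons append_Nil append_butlast_last_id)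
      ultimately have "active D U (xs @ [?n])" by simp
      then show False using sep xs(1,2) Y(1) unfolding connected_given_def
        by (metis append_is_Nil_conv hd_append2 last_snoc)
    qed
    moreover have "\<not> connected_given D U Z Y'"
      using sep Y'(2) connected_given_Un[of D U Z "{?n}" Y'] by auto
    ultimately have sep': "\<not> connected_given D U Z (Y' \<union> Q)" by (simp add: connected_given_Un)
    have ZQ: "Z \<inter> (Y' \<union> Q) = {}" by (rule disjoint_if_not_connected_given[OF sep'])
    have "(Y' \<union> Q) \<inter> U = {}" using Y'(2) ZU(4) by (auto simp: Q_def)
    then have "ci q Z (Y' \<union> Q) U"
      using Suc.IH[OF _ _ _ _ _ _ _ sep'] Suc.prems(1) Y'(1) ZU Q ZQ by simp
    moreover have "ci q Z {?n} ((Y' \<union> Q) \<union> U)"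
    proof -
      have "ci q {?n} Z ((Y' \<union> U) \<union> ?P)"
        using ZU Y' ZQ by (intro local_n) (auto simp: Q_def)
      moreover have "(Y' \<union> U) \<union> ?P = (Y' \<union> Q) \<union> U" by (auto simp: Q_def)
      ultimately show ?thesis by (simp add: ci_sym)
    qed
    ultimately have "ci q Z ((Y' \<union> Q) \<union> {?n}) U" by (rule ci_contraction)
    moreover have "(Y' \<union> Q) \<union> {?n} = Y \<union> (Q - Y')" using Y' by auto
    ultimately have "ci q Z (Y \<union> (Q - Y')) U" by simp
    then show ?thesis
      by (rule ci_decomposition) (use Y' ZQ Q in \<open>auto simp: Q_def\<close>)
  qed
  \<comment> \<open>As before, \<open>Z\<close> first absorbs the unconditioned parents and then the
    last vertex; finally weak union moves the last vertex into the condition.\<close>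
  have case_U: "ci q Y Z (insert ?n U)"
    if sub: "Y \<subseteq> {1..n}" "Z \<subseteq> {1..n}" "U \<subseteq> {1..n}" and disj: "Y \<inter> Z = {}" "Y \<inter> U = {}" "Z \<inter> U = {}"
      and sep_Z: "\<not> connected_given D U Y Z" and sep_P: "\<not> connected_given D U Y (?P - U)"
    for Y Z U
  proof -
    define Q where "Q = ?P - U"
    have sep': "\<not> connected_given D U Y (Z \<union> Q)"
      using sep_Z sep_P by (simp add: connected_given_Un Q_def)
    have YQ: "Y \<inter> (Z \<union> Q) = {}" by (rule disjoint_if_not_connected_given[OF sep'])
    have "Q \<subseteq> {1..n}" "(Z \<union> Q) \<inter> U = {}" using P disj(3) by (auto simp: Q_def)
    then have "ci q Y (Z \<union> Q) U"
      using Suc.IH[OF _ _ _ _ _ _ _ sep'] Suc.prems(1) sub disj YQ by simp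
    moreover have "ci q Y {?n} ((Z \<union> Q) \<union> U)"
    proof -
      have "ci q {?n} Y ((Z \<union> U) \<union> ?P)"
        using sub disj YQ by (intro local_n) (auto simp: Q_def)
      moreover have "(Z \<union> U) \<union> ?P = (Z \<union> Q) \<union> U" by (auto simp: Q_def)
      ultimately show ?thesis by (simp add: ci_sym)
    qed
    ultimately have "ci q Y ((Z \<union> Q) \<union> {?n}) U" by (rule ci_contraction)
    moreover have "(Z \<union> Q) \<union> {?n} = (Z \<union> {?n}) \<union> (Q - Z)" by auto
    ultimately have "ci q Y ((Z \<union> {?n}) \<union> (Q - Z)) U" by simp
    then have "ci q Y (Z \<union> {?n}) U"
      by (rule ci_decomposition) (use YQ P in \<open>auto simp: Q_def\<close>)
    then have "ci q Y Z (U \<union> {?n})"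
      by (rule ci_weak_union) (use sub disj in auto)
    then show ?thesis by simp
  qed
  have smaller: "T \<subseteq> {1..n}" if "T \<subseteq> {1..?n}" "?n \<notin> T" for T
    using that by (auto simp: subset_iff le_Suc_eq)
  consider (Y) "?n \<in> Y" | (Z) "?n \<in> Z" | (U) "?n \<in> U" | (none) "?n \<notin> Y" "?n \<notin> Z" "?n \<notin> U"
    by blast
  then show ?case
  proof cases
    case Y
    then have "?n \<notin> Z" "?n \<notin> U" using Suc.prems by auto
    then have "ci q Z Y U"
      using Suc.prems Y by (intro case_Y smaller) (auto dest: connected_given_sym)
    then show ?thesis by (rule ci_sym)
  next
    case Z
    then have "?n \<notin> Y" "?n \<notin> U" using Suc.prems by auto
    then show ?thesis
      using Suc.prems Z by (intro case_Y smaller) auto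
  next
    case U
    define U' where "U' = U - {?n}"
    have U': "U = insert ?n U'" "U' \<subseteq> {1..n}" "?n \<notin> U'"
      using U Suc.prems(4) smaller[of U'] by (auto simp: U'_def)
    have YZ: "Y \<subseteq> {1..n}" "Z \<subseteq> {1..n}" 
      using U Suc.prems smaller[of Y] smaller[of Z] by blast+
    \<comment> \<open>By \<open>active_le\<close> such a walk stays within the first
      \<open>n\<close> vertices, so conditioning on the last vertex as well leaves it
      active.\<close>
    have lift: "active D U xs" "?n \<notin> set xs"
      if "xs \<noteq> []" "hd xs \<in> {1..n}" "last xs \<in> {1..n}" "active D U' xs" for xs
    proof -
      have "s \<le> n" if "s \<in> U'" for s using that U'(2) by auto
      then have "x \<le> n" if "x \<in> set xs" for x
        using active_le[OF ord \<open>active D U' xs\<close> \<open>xs \<noteq> []\<close>, of n x] that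
          \<open>hd xs \<in> {1..n}\<close> \<open>last xs \<in> {1..n}\<close> by simp
      then show "?n \<notin> set xs" by force
      then show "active D U xs" using that(4) U'(1) active_insert by metis
    qed
    have sep: "\<not> connected_given D U' Y Z"
    proof
      assume "connected_given D U' Y Z"
      then obtain xs where "xs \<noteq> []" "hd xs \<in> Y" "last xs \<in> Z" "active D U' xs"
        unfolding connected_given_def by blast
      with lift[of xs] YZ Suc.prems(8) show False unfolding connected_given_def by blast
    qed
    \<comment> \<open>Otherwise walks from \<open>Y\<close> and from \<open>Z\<close> to parents of
      the last vertex could be joined there: the last vertex is a collider and belongs to
      \<open>U\<close>, so the joined walk is active.\<close>
    have "\<not> connected_given D U' Y (?P - U') \<or> \<not> connected_given D U' Z (?P - U')"
    proof (rule ccontr)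
      assume "\<not> ?thesis"
      then obtain xs ys where
        xs: "xs \<noteq> []" "hd xs \<in> Y" "last xs \<in> ?P - U'" "active D U' xs" and
        ys: "ys \<noteq> []" "hd ys \<in> Z" "last ys \<in> ?P - U'" "active D U' ys"
        unfolding connected_given_def by blast
      have xs': "active D U xs" "?n \<notin> set xs" and ys': "active D U ys" "?n \<notin> set ys"
        using lift[of xs] lift[of ys] xs ys YZ P by (meson DiffD1 subsetD)+
      have extend: "active D U (zs @ [?n])"
        if "zs \<noteq> []" "last zs \<in> ?P - U'" "active D U zs" for zs
      proof -
        have "(last zs, ?n) \<in> D" using that(2) by (auto simp: pa_def)
        moreover from this have "(?n, last zs) \<notin> D" "last zs \<noteq> ?n"
          using ord[of "last zs" ?n] ord[of ?n "last zs"] by auto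
        ultimately have "active D U (butlast zs @ last zs # [?n])"
          using that U'(1) by (subst active_append) (auto simp: open_at_def)
        moreover have "butlast zs @ last zs # [?n] = zs @ [?n]" using that(1)
          by (metis append.assoc append_Cons append_Nil append_butlast_last_id)
        ultimately show ?thesis by simp
      qed
      have "active D U (?n # rev ys)"
        using extend[OF ys(1,3) ys'(1)] active_rev[of D U "ys @ [?n]"] by simp
      moreover have "open_at D U (last xs) ?n (hd (rev ys))"
        using xs(1,3) ys(1,3) U'(1) by (auto simp: open_at_def pa_def hd_rev)
      ultimately have "active D U (xs @ ?n # rev ys)"
        using extend[OF xs(1,3) xs'(1)] by (subst active_append) auto
      moreover have "last (xs @ ?n # rev ys) \<in> Z" "hd (xs @ ?n # rev ys) \<in> Y"
        using xs ys by (auto simp: last_rev)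
      ultimately show False
        using Suc.prems(8) unfolding connected_given_def by blast
    qed
    then show ?thesis
    proof
      assume "\<not> connected_given D U' Y (?P - U')"
      then show ?thesis unfolding U'(1)
        using YZ U' Suc.prems sep by (intro case_U) auto
    next
      assume "\<not> connected_given D U' Z (?P - U')"
      then have "ci q Z Y U" unfolding U'(1)
        using YZ U' Suc.prems sep by (intro case_U) (auto dest: connected_given_sym)
      then show ?thesis by (rule ci_sym)
    qed
  next
    case none
    then show ?thesis using Suc.prems by (intro Suc.IH smaller) auto
  qed
qed

section \<open>Intervention kernels\<close>

lemma pre_Suc: "1 \<le> i \<Longrightarrow> pre (Suc i) = insert i (pre i)"
  by (auto simp: pre_def)

lemma do_regime_cong: "agree C c c' \<Longrightarrow> do_regime C c = do_regime C c'"
  by (auto simp: agree_def do_regime_def fun_eq_iff)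

lemma do_regime_in_regimes: "C \<subseteq> A \<Longrightarrow> c \<in> PiE C X \<Longrightarrow> do_regime C c \<in> regimes X A"
  by (fastforce simp: regimes_def do_regime_def dom_def split: if_splits)

locale causal_kernel =
  fixes p :: nat and E :: "(nat \<times> nat) set" and A :: "nat set"
    and X :: "nat \<Rightarrow> 'x set" and K :: "(nat \<rightharpoonup> 'x) \<Rightarrow> (nat \<Rightarrow> 'x) pmf"
  assumes dag: "ordered_dag p E"
    and targets: "A \<subseteq> {1..p}"
    and kernel: "intervention_kernel p X A K"
    and consistency: "distributional_consistency p X A K"
    and local_markov: "augmented_local_markov p X A E K"
begin

abbreviation obs :: "(nat \<Rightarrow> 'x) pmf" where "obs \<equiv> K Map.empty"

abbreviation interv :: "(nat \<Rightarrow> 'x) \<Rightarrow> (nat \<Rightarrow> 'x) pmf" where "interv a \<equiv> K (do_regime A a)"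

lemma pa_subset_pre: "pa E i \<subseteq> pre i"
  using dag by (fastforce simp: ordered_dag_def pa_def pre_def)

lemma support_obs: "set_pmf obs \<subseteq> PiE {1..p} X"
  using kernel by (auto simp: intervention_kernel_def regimes_def)

lemma support_interv: "a \<in> PiE A X \<Longrightarrow> set_pmf (interv a) \<subseteq> PiE {1..p} X"
  using kernel do_regime_in_regimes[of A A a X] by (auto simp: intervention_kernel_def)

text \<open>Comparing two regimes and two histories eliminates the function \<open>k\<close> of the
  local Markov property, and multiplying out includes histories of probability zero.\<close>

lemma interv_local_markov:
  assumes a: "a \<in> PiE A X" and a': "a' \<in> PiE A X" and i: "i \<in> {1..p}"
    and aa': "agree (A \<inter> pa E i) a a'" and ww': "agree (insert i (pa E i - A)) w w'"
  shows "marg (interv a) (insert i (pre i)) w * marg (interv a') (pre i) w' =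
    marg (interv a') (insert i (pre i)) w' * marg (interv a) (pre i) w"
proof (cases "marg (interv a) (pre i) w = 0 \<or> marg (interv a') (pre i) w' = 0 \<or> w i \<notin> X i")
  case True
  have "marg (interv b) (insert i (pre i)) v = 0" if "w i \<notin> X i" "v i = w i" "b \<in> PiE A X" for b v
    using marg_eq_0_outside[OF support_interv[OF that(3)], of i "insert i (pre i)" v] i that(1,2)
    by simp
  moreover have "w' i = w i" using ww' by (simp add: agree_def)
  moreover have "marg (interv b) (insert i (pre i)) v = 0" if "marg (interv b) (pre i) v = 0" for b v
    using marg_eq_0_mono[OF that, of "insert i (pre i)"] by auto
  ultimately show ?thesis using True a a' by auto
next
  case False
  from local_markov i obtain k where k: "\<And>b v x. b \<in> PiE A X \<Longrightarrow> v \<in> PiE (pre i) X \<Longrightarrow>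
      \<P>(u in measure_pmf (interv b). agree (pre i) u v) > 0 \<Longrightarrow> x \<in> X i \<Longrightarrow>
      \<P>(u in measure_pmf (interv b). u i = x \<bar> agree (pre i) u v) =
        k (restrict b (A \<inter> pa E i)) (restrict v (pa E i - A)) x"
    unfolding augmented_local_markov_def by blast
  have ratio: "marg (interv b) (insert i (pre i)) v =
      k (restrict b (A \<inter> pa E i)) (restrict v (pa E i - A)) (v i) * marg (interv b) (pre i) v"
    if b: "b \<in> PiE A X" and nz: "marg (interv b) (pre i) v \<noteq> 0" and vi: "v i \<in> X i" for b v
  proof -
    \<comment> \<open>The local Markov property speaks of extensional histories in the product
      space; positive probability forces the values of \<open>v\<close> into the state
      spaces.\<close>
    define v' where "v' = restrict v (pre i)"
    have eqs: "agree (pre i) u v' \<longleftrightarrow> agree (pre i) u v" for u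
      by (auto simp: agree_def v'_def)
    have "v j \<in> X j" if "j \<in> pre i" for j
      using marg_eq_0_outside[OF support_interv[OF b], of j "pre i" v] nz that i
      by (auto simp: pre_def)
    then have "v' \<in> PiE (pre i) X" by (auto simp: v'_def)
    moreover have "\<P>(u in measure_pmf (interv b). agree (pre i) u v') > 0"
      using nz unfolding eqs by (simp add: marg_def zero_less_measure_iff)
    moreover have "restrict v' (pa E i - A) = restrict v (pa E i - A)"
      using pa_subset_pre[of i] by (auto simp: v'_def restrict_def fun_eq_iff)
    ultimately have "\<P>(u in measure_pmf (interv b). u i = v i \<bar> agree (pre i) u v') =
        k (restrict b (A \<inter> pa E i)) (restrict v (pa E i - A)) (v i)"
      using k[OF b, of v'] vi by simp
    moreover have "\<P>(u in measure_pmf (interv b). u i = v i \<bar> agree (pre i) u v') =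
        marg (interv b) (insert i (pre i)) v / marg (interv b) (pre i) v"
      unfolding eqs by (simp add: cond_prob_def marg_def agree_def)
    ultimately show ?thesis using nz by (simp add: field_simps)
  qed
  have "restrict a (A \<inter> pa E i) = restrict a' (A \<inter> pa E i)"
    "restrict w (pa E i - A) = restrict w' (pa E i - A)" "w i = w' i"
    using aa' ww' by (auto simp: agree_def restrict_def fun_eq_iff)
  then show ?thesis using ratio[OF a, of w] ratio[OF a', of w'] False by simp
qed

text \<open>Chain rule along the ordering. The marginal covers \<open>{1..n}\<close> but the regimes
  need only agree on targets below \<open>n\<close>: the indicator of \<open>n\<close> points to the
  children of \<open>n\<close>, never to \<open>n\<close> itself.\<close>

lemma interv_depends_on_predecessors:
  assumes "a \<in> PiE A X" "a' \<in> PiE A X"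
  shows "n \<le> p \<Longrightarrow> agree (A \<inter> pre n) a a' \<Longrightarrow>
    marg (interv a) (pre (Suc n)) w = marg (interv a') (pre (Suc n)) w"
proof (induction n)
  case 0
  then show ?case by (simp add: pre_def)
next
  case (Suc n)
  let ?n = "Suc n"
  have IH: "marg (interv a) (pre ?n) w = marg (interv a') (pre ?n) w"
    using Suc by (intro Suc.IH) (auto simp: agree_def pre_def)
  have "agree (A \<inter> pa E ?n) a a'"
    using Suc.prems(2) by (rule agree_subset) (use pa_subset_pre in blast)
  then have "marg (interv a) (insert ?n (pre ?n)) w * marg (interv a') (pre ?n) w =
      marg (interv a') (insert ?n (pre ?n)) w * marg (interv a) (pre ?n) w"
    using assms Suc.prems(1) by (intro interv_local_markov) (auto simp: agree_def)
  moreover have "marg (interv b) (insert ?n (pre ?n)) w = 0" if "marg (interv b) (pre ?n) w = 0" for b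
    using marg_eq_0_mono[OF that, of "insert ?n (pre ?n)"] by auto
  ultimately show ?case
    using IH by (cases "marg (interv a) (pre ?n) w = 0") (auto simp: pre_Suc)
qed

text \<open>Each target is set to the value it has in \<open>w\<close>, so consistency applies again
  after every single addition.\<close>

lemma consistency_iterated:
  assumes "w \<in> PiE {1..p} X" "finite C" "C \<subseteq> A"
  shows "pmf (K (do_regime C w)) w = pmf obs w"
  using assms(2,3)
proof (induction C rule: finite_induct)
  case empty
  then show ?case by (simp add: do_regime_def)
next
  case (insert j C)
  have eq: "do_regime C (restrict w C) = do_regime C w"
    by (rule do_regime_cong) (simp add: agree_def)
  have "restrict w C \<in> PiE C X" using assms(1) insert.prems targets by auto
  then have "pmf (K ((do_regime C w)(j \<mapsto> w j))) w = pmf (K (do_regime C w)) w"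
    using consistency insert.hyps insert.prems assms(1)
    unfolding distributional_consistency_def eq[symmetric] by blast
  moreover have "(do_regime C w)(j \<mapsto> w j) = do_regime (insert j C) w"
    by (auto simp: do_regime_def)
  ultimately show ?case using insert by simp
qed

text \<open>Summing out the last vertex first: at stage \<open>n\<close> the regime may follow \<open>w\<close> on all
  targets up to \<open>n\<close>, because the first \<open>n\<close> variables ignore later regimes.\<close>

lemma obs_eq_interv:
  assumes "n \<le> p"
  shows "a \<in> PiE A X \<Longrightarrow> agree (A \<inter> {1..n}) a w \<Longrightarrow>
    marg obs (pre (Suc n)) w = marg (interv a) (pre (Suc n)) w"
  using assms
proof (induction n arbitrary: a w rule: inc_induct)
  case base
  have pre_p: "pre (Suc p) = {1..p}" by (auto simp: pre_def)
  show ?case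
  proof (cases "\<forall>i\<in>{1..p}. w i \<in> X i")
    case True
    define w' where "w' = restrict w {1..p}"
    have w': "w' \<in> PiE {1..p} X" using True by (auto simp: w'_def)
    have "agree {1..p} w w'" by (auto simp: agree_def w'_def)
    note eq = marg_cong[OF this]
    have "do_regime A a = do_regime A w'"
      using base(2) targets by (intro do_regime_cong) (auto simp: agree_def w'_def subset_iff)
    then have "pmf (interv a) w' = pmf obs w'"
      using consistency_iterated[OF w', of A] finite_subset[OF targets] by simp
    then show ?thesis
      unfolding pre_p eq marg_full[OF support_obs w'] marg_full[OF support_interv[OF base(1)] w']
      by simp
  next
    case False
    then obtain i where "i \<in> {1..p}" "w i \<notin> X i" by blast
    then show ?thesis
      using marg_eq_0_outside[OF support_obs, of i "{1..p}" w]
        marg_eq_0_outside[OF support_interv[OF base(1)], of i "{1..p}" w] by (simp add: pre_p)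
  qed
next
  case (step n)
  let ?j = "Suc n"
  have insert_j: "pre (Suc n) \<union> {?j} = pre (Suc ?j)" by (auto simp: pre_def)
  have "1 * marg obs (pre (Suc n)) w = 1 * marg (interv a) (pre (Suc n)) w"
  proof (rule marg_sum_out[where W = "{?j}"])
    fix w' assume w': "agree (- {?j}) w' w"
    have eq: "marg obs (pre (Suc ?j)) w' = marg (interv a) (pre (Suc ?j)) w'"
    proof (cases "w' ?j \<in> X ?j")
      case True
      \<comment> \<open>The regime at \<open>?j\<close> must follow the value being summed over.
        Returning from \<open>a'\<close> to \<open>a\<close> leaves the marginal up to
        \<open>?j\<close> unchanged, since only targets strictly below \<open>?j\<close> affect
        it.\<close>
      define a' where "a' = (if ?j \<in> A then a(?j := w' ?j) else a)"
      have a': "a' \<in> PiE A X" using True step.prems(1) by (auto simp: a'_def PiE_iff extensional_def)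
      have "agree (A \<inter> {1..?j}) a' w'"
        using step.prems(2) w' by (auto simp: agree_def a'_def le_Suc_eq)
      from step.IH[OF a' this] have "marg obs (pre (Suc ?j)) w' = marg (interv a') (pre (Suc ?j)) w'" .
      also have "\<dots> = marg (interv a) (pre (Suc ?j)) w'"
        using step.hyps a' step.prems(1)
        by (intro interv_depends_on_predecessors) (auto simp: agree_def a'_def pre_def)
      finally show ?thesis .
    next
      case False
      have "?j \<in> {1..p}" "?j \<in> pre (Suc ?j)" using step.hyps by (auto simp: pre_def)
      then show ?thesis
        using False marg_eq_0_outside[OF support_obs, of ?j "pre (Suc ?j)" w']
          marg_eq_0_outside[OF support_interv[OF step.prems(1)], of ?j "pre (Suc ?j)" w'] by simp
    qed
    then show "1 * marg obs (pre (Suc n) \<union> {?j}) w' = 1 * marg (interv a) (pre (Suc n) \<union> {?j}) w'"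
      unfolding insert_j by simp
  qed (auto simp: pre_def)
  then show ?case by simp
qed

section \<open>The identification formula\<close>

lemma marg_parent_event:
  "marg obs (pa E i) (override_on v a (pa E i \<inter> A)) =
    \<P>(w in measure_pmf obs. parent_event A E a v i w)"
  "marg obs (insert i (pa E i)) (override_on v a (pa E i \<inter> A)) =
    \<P>(w in measure_pmf obs. w i = v i \<and> parent_event A E a v i w)"
proof -
  \<comment> \<open>Target parents take their values from \<open>a\<close>, all others from
    \<open>v\<close>; one glued assignment turns the parent event into a marginal that
    \<open>marg_sum_out\<close> can handle.\<close>
  have eq: "agree (pa E i) w (override_on v a (pa E i \<inter> A)) \<longleftrightarrow> parent_event A E a v i w" for w
    by (auto simp: agree_def parent_event_def override_on_def)
  have "i \<notin> pa E i" using pa_subset_pre[of i] by (auto simp: pre_def)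
  then have eq': "agree (insert i (pa E i)) w (override_on v a (pa E i \<inter> A)) \<longleftrightarrow>
      w i = v i \<and> parent_event A E a v i w" for w
    unfolding eq[symmetric] by (auto simp: agree_def override_on_def)
  show "marg obs (pa E i) (override_on v a (pa E i \<inter> A)) =
      \<P>(w in measure_pmf obs. parent_event A E a v i w)"
    "marg obs (insert i (pa E i)) (override_on v a (pa E i \<inter> A)) =
      \<P>(w in measure_pmf obs. w i = v i \<and> parent_event A E a v i w)"
    by (simp_all add: marg_def eq eq')
qed

text \<open>The identification formula, multiplied out to avoid division by zero.\<close>

lemma interv_obs_cross:
  assumes a: "a \<in> PiE A X" and v: "v \<in> PiE {1..p} X" and i: "i \<in> {1..p}"
  shows "marg (interv a) (pre i) v * \<P>(w in measure_pmf obs. w i = v i \<and> parent_event A E a v i w) =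
    marg (interv a) (insert i (pre i)) v * \<P>(w in measure_pmf obs. parent_event A E a v i w)"
  unfolding marg_parent_event[symmetric]
\<comment> \<open>Sum over the non-parent predecessors; the two interventional marginals at
  \<open>v\<close> are the constant coefficients.\<close>
proof (rule marg_sum_out[where W = "pre i - pa E i"])
  let ?v = "override_on v a (pa E i \<inter> A)"
  have unions: "insert i (pa E i) \<union> (pre i - pa E i) = insert i (pre i)"
    "pa E i \<union> (pre i - pa E i) = pre i" using pa_subset_pre[of i] by auto
  fix w assume w: "agree (- (pre i - pa E i)) w ?v"
  have "i \<notin> pre i" by (simp add: pre_def)
  then have w_pa: "agree (pa E i \<inter> A) w a" "agree (insert i (pa E i - A)) w v"
    using w pa_subset_pre[of i] by (auto simp: agree_def override_on_def)
  have wi: "w i \<in> X i" using w_pa(2) v i by (auto simp: agree_def)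
  show "marg (interv a) (pre i) v * marg obs (insert i (pa E i) \<union> (pre i - pa E i)) w =
      marg (interv a) (insert i (pre i)) v * marg obs (pa E i \<union> (pre i - pa E i)) w"
    unfolding unions
  proof (cases "\<forall>j\<in>pre i. w j \<in> X j")
    case True
    \<comment> \<open>The regime \<open>b\<close> follows \<open>w\<close> on targets up to
      \<open>i\<close>, so observational marginals at \<open>w\<close> become marginals under
      \<open>b\<close>. On target parents \<open>w\<close> equals \<open>a\<close>, hence so does
      \<open>b\<close>, and the local Markov property compares \<open>b\<close> with
      \<open>a\<close>.\<close>
    define b where "b = override_on a w (A \<inter> {1..i})"
    have b: "b \<in> PiE A X"
      using a True wi by (auto simp: b_def PiE_iff extensional_def override_on_def pre_def le_less)
    have bw: "agree (A \<inter> {1..i}) b w" by (auto simp: b_def agree_def)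
    have Suc_i: "Suc (i - 1) = i" using i by simp
    have "marg obs (insert i (pre i)) w = marg (interv b) (insert i (pre i)) w"
      using obs_eq_interv[of i, OF _ b bw] i pre_Suc[of i] by simp
    moreover have "marg obs (pre i) w = marg (interv b) (pre i) w"
      using obs_eq_interv[of "i - 1" b w] b agree_subset[OF bw, of "A \<inter> {1..i - 1}"] i Suc_i
      by (simp add: subset_iff)
    moreover have "agree (A \<inter> pa E i) b a"
      using w_pa(1) pa_subset_pre[of i] by (auto simp: b_def agree_def override_on_def)
    then have "marg (interv b) (insert i (pre i)) w * marg (interv a) (pre i) v =
        marg (interv a) (insert i (pre i)) v * marg (interv b) (pre i) w"
      using interv_local_markov[OF b a i] w_pa(2) by blast
    ultimately show "marg (interv a) (pre i) v * marg obs (insert i (pre i)) w =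
        marg (interv a) (insert i (pre i)) v * marg obs (pre i) w" by (simp add: mult.commute)
  next
    case False
    then obtain j where j: "j \<in> pre i" "w j \<notin> X j" by blast
    moreover have "j \<in> {1..p}" using j i by (auto simp: pre_def)
    ultimately have "marg obs (pre i) w = 0" "marg obs (insert i (pre i)) w = 0"
      by (auto intro: marg_eq_0_outside[OF support_obs])
    then show "marg (interv a) (pre i) v * marg obs (insert i (pre i)) w =
        marg (interv a) (insert i (pre i)) v * marg obs (pre i) w" by simp
  qed
qed (use pa_subset_pre[of i] in \<open>auto simp: pre_def\<close>)

lemma interv_cond_eq_obs_cond:
  assumes "a \<in> PiE A X" "v \<in> PiE {1..p} X" "i \<in> {1..p}"
    and "\<P>(w in measure_pmf (interv a). agree (pre i) w v) > 0"
    and "\<P>(w in measure_pmf obs. parent_event A E a v i w) > 0"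
  shows "\<P>(w in measure_pmf (interv a). w i = v i \<bar> agree (pre i) w v) =
    \<P>(w in measure_pmf obs. w i = v i \<bar> parent_event A E a v i w)"
proof -
  have "\<P>(w in measure_pmf (interv a). agree (pre i) w v) = marg (interv a) (pre i) v"
    "\<P>(w in measure_pmf (interv a). w i = v i \<and> agree (pre i) w v) =
      marg (interv a) (insert i (pre i)) v"
    by (simp_all add: marg_def agree_def)
  then show ?thesis
    using interv_obs_cross[OF assms(1-3)] assms(4,5) by (simp add: cond_prob_def field_simps)
qed

section \<open>Markov property of the interventional distribution\<close>

definition cut_dag :: "(nat \<times> nat) set" where
  "cut_dag = {(i, j) \<in> E. i \<notin> A}"

lemma cut_dag_less: "(i, j) \<in> cut_dag \<Longrightarrow> i < j"
  using dag by (auto simp: cut_dag_def ordered_dag_def)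

lemma acyclic_cut_dag: "acyclic cut_dag"
  using dag by (auto simp: cut_dag_def ordered_dag_def intro: acyclic_subset)

text \<open>Apply the local Markov property with the same regime twice and histories differing only
  off the remaining parents, then sum out one of the histories.\<close>

lemma interv_ci_parents:
  assumes a: "a \<in> PiE A X" and i: "i \<in> {1..p}"
  shows "ci (interv a) {i} (pre i - pa cut_dag i) (pa cut_dag i)"
  unfolding ci_def
proof
  fix w
  let ?P = "pa cut_dag i"
  have P: "?P = pa E i - A" by (auto simp: pa_def cut_dag_def)
  have sub: "?P \<subseteq> pre i" using P pa_subset_pre[of i] by auto
  have "marg (interv a) (pre i) w * marg (interv a) (insert i ?P) w =
      marg (interv a) (insert i (pre i)) w * marg (interv a) ?P w"
  proof (rule marg_sum_out[where W = "pre i - ?P"])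
    fix w' assume w': "agree (- (pre i - ?P)) w' w"
    have "agree (insert i (pa E i - A)) w' w"
      by (rule agree_subset[OF w']) (auto simp: P pre_def)
    moreover have "insert i ?P \<union> (pre i - ?P) = insert i (pre i)" "?P \<union> (pre i - ?P) = pre i"
      using sub by auto
    ultimately show "marg (interv a) (pre i) w * marg (interv a) (insert i ?P \<union> (pre i - ?P)) w' =
        marg (interv a) (insert i (pre i)) w * marg (interv a) (?P \<union> (pre i - ?P)) w'"
      using interv_local_markov[OF a a i, of w' w] by (simp add: agree_def mult.commute)
  qed (auto simp: pre_def)
  moreover have "{i} \<union> (pre i - ?P) \<union> ?P = insert i (pre i)" "(pre i - ?P) \<union> ?P = pre i"
    using sub by auto
  ultimately show "marg (interv a) ({i} \<union> (pre i - ?P) \<union> ?P) w * marg (interv a) ?P w =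
      marg (interv a) ({i} \<union> ?P) w * marg (interv a) (pre i - ?P \<union> ?P) w"
    by (simp add: mult.commute)
qed

abbreviation cut_augmented_dag :: "(vertex \<times> vertex) set" where
  "cut_augmented_dag \<equiv> remove_outgoing (Var ` A) (augmented_dag A E)"

text \<open>Under \<open>F_A = a\<close> the indicators are constants, so the soundness argument
  runs on the variables alone; this carries its walks into the augmented graph.\<close>

lemma Var_edge_iff: "(Var i, Var j) \<in> cut_augmented_dag \<longleftrightarrow> (i, j) \<in> cut_dag"
  by (auto simp: remove_outgoing_def augmented_dag_def cut_dag_def)

lemma Var_rtrancl: "(i, j) \<in> cut_dag\<^sup>* \<Longrightarrow> (Var i, Var j) \<in> cut_augmented_dag\<^sup>*"
  by (induction rule: rtrancl_induct) (auto simp: Var_edge_iff intro: rtrancl_into_rtrancl)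

text \<open>Paths through regime indicators can be ignored here: d-separation in the augmented graph
  is only used to exclude active walks among the variables.\<close>

lemma not_connected_if_d_separated:
  assumes "d_separated cut_augmented_dag (Var ` Y) (Var ` Z) (Var ` U \<union> Reg ` A)"
  shows "\<not> connected_given cut_dag U Y Z"
proof
  assume "connected_given cut_dag U Y Z"
  then obtain xs where "xs \<noteq> []" "hd xs \<in> Y" "last xs \<in> Z" "active cut_dag U xs"
    unfolding connected_given_def by blast
  \<comment> \<open>\<open>d_separated\<close> quantifies over paths without repetition, so the walk
    must first be made distinct.\<close>
  then obtain ys where ys: "ys \<noteq> []" "distinct ys" "hd ys \<in> Y" "last ys \<in> Z" "active cut_dag U ys"
    using active_walk_to_path[OF acyclic_cut_dag, of U xs] by auto
  have "graph_path cut_augmented_dag (map Var ys)"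
    using ys(1,2) active_nth(1)[OF ys(5)]
    by (auto simp: graph_path_def Var_edge_iff distinct_map inj_on_def)
  moreover have "hd (map Var ys) \<in> Var ` Y" "last (map Var ys) \<in> Var ` Z"
    using ys by (simp_all add: hd_map last_map)
  ultimately have "blocked cut_augmented_dag (Var ` U \<union> Reg ` A) (map Var ys)"
    using assms unfolding d_separated_def by blast
  then obtain k where k: "0 < k" "Suc k < length ys" and
    blocked: "if collider cut_augmented_dag (map Var ys) k
      then \<forall>s\<in>Var ` U \<union> Reg ` A. (Var (ys ! k), s) \<notin> cut_augmented_dag\<^sup>*
      else Var (ys ! k) \<in> Var ` U \<union> Reg ` A"
    unfolding blocked_def by (auto simp: nth_map cong: if_cong)
  have "open_at cut_dag U (ys ! (k - 1)) (ys ! k) (ys ! Suc k)"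
    using active_nth(2)[OF ys(5) k(2,1)] .
  moreover have "collider cut_augmented_dag (map Var ys) k \<longleftrightarrow>
      (ys ! (k - 1), ys ! k) \<in> cut_dag \<and> (ys ! Suc k, ys ! k) \<in> cut_dag"
    using k by (simp add: collider_def Var_edge_iff)
  ultimately show False
    using blocked Var_rtrancl by (auto simp: open_at_def split: if_splits)
qed

lemma interv_markov_property:
  assumes "a \<in> PiE A X"
  shows "markov_property p X A cut_augmented_dag (interv a)"
  unfolding markov_property_def
proof (intro allI impI, elim conjE)
  fix Y Z U
  assume sets: "Y \<subseteq> {1..p}" "Z \<subseteq> {1..p}" "U \<subseteq> {1..p}" "Y \<inter> Z = {}" "Y \<inter> U = {}" "Z \<inter> U = {}"
    and "d_separated cut_augmented_dag (Var ` Y) (Var ` Z) (Var ` U \<union> Reg ` A)"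
  then have "\<not> connected_given cut_dag U Y Z" by (intro not_connected_if_d_separated)
  moreover have "cut_dag \<subseteq> {1..p} \<times> {1..p}"
    using dag by (auto simp: cut_dag_def ordered_dag_def)
  ultimately have "ci (interv a) Y Z U"
    using ci_if_not_connected_given[OF cut_dag_less _ interv_ci_parents[OF assms], of p p] sets
    by blast
  then show "cond_indep X (interv a) Y Z U" using sets by (intro ci_imp_cond_indep)
qed

end

text \<open>Induction along the chain rule: the proviso makes the parent event positive, so
  \<open>interv_obs_cross\<close> can be solved for the next marginal in terms of the previous one
  and observational probabilities, which both kernels share.\<close>

lemma interv_identified:
  assumes K: "causal_kernel p E A X K" and K': "causal_kernel p E A X K'"
    and same: "K' Map.empty = K Map.empty"
    and ident: "cond_dists_identified p X A E a (K Map.empty)"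
    and a: "a \<in> PiE A X"
  shows "K' (do_regime A a) = K (do_regime A a)"
proof -
  interpret K: causal_kernel p E A X K by fact
  interpret K': causal_kernel p E A X K' by fact
  have eq: "marg (K'.interv a) (pre (Suc n)) v = marg (K.interv a) (pre (Suc n)) v"
    if v: "v \<in> PiE {1..p} X" and "n \<le> p" for v n
    using that(2)
  proof (induction n)
    case 0
    then show ?case by (simp add: pre_def)
  next
    case (Suc n)
    then have i: "Suc n \<in> {1..p}" by simp
    have "\<P>(w in measure_pmf K.obs. parent_event A E a v (Suc n) w) > 0"
      using ident v i unfolding cond_dists_identified_def by blast
    then show ?case
      using K.interv_obs_cross[OF a v i] K'.interv_obs_cross[OF a v i] Suc.IH Suc.prems
      by (simp add: same pre_Suc)
  qed
  have pre_p: "pre (Suc p) = {1..p}" by (auto simp: pre_def)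
  show ?thesis
  proof (rule pmf_eqI)
    fix v
    show "pmf (K'.interv a) v = pmf (K.interv a) v"
    proof (cases "v \<in> PiE {1..p} X")
      case True
      then show ?thesis
        using eq[OF True, of p] marg_full[OF K.support_interv[OF a] True]
          marg_full[OF K'.support_interv[OF a] True] by (simp add: pre_p)
    next
      case False
      then show ?thesis
        using K.support_interv[OF a] K'.support_interv[OF a]
        by (metis pmf_eq_0_set_pmf subsetD)
    qed
  qed
qed

theorem theorem21:
  fixes p :: nat and E :: "(nat \<times> nat) set" and A :: "nat set"
    and X :: "nat \<Rightarrow> 'x set" and K :: "(nat \<rightharpoonup> 'x) \<Rightarrow> (nat \<Rightarrow> 'x) pmf"
    and a :: "nat \<Rightarrow> 'x"
  assumes dag: "ordered_dag p E"
    and targets: "A \<subseteq> {1..p}"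
    and kernel: "intervention_kernel p X A K"
    and consistency: "distributional_consistency p X A K"
    and local_markov: "augmented_local_markov p X A E K"
    and a: "a \<in> PiE A X"
  shows
    "(\<forall>v\<in>PiE {1..p} X. \<forall>i\<in>{1..p}.
        \<P>(w in measure_pmf (K (do_regime A a)). agree (pre i) w v) > 0 \<longrightarrow>
        \<P>(w in measure_pmf (K Map.empty). parent_event A E a v i w) > 0 \<longrightarrow>
        \<P>(w in measure_pmf (K (do_regime A a)). w i = v i \<bar> agree (pre i) w v) =
        \<P>(w in measure_pmf (K Map.empty). w i = v i \<bar> parent_event A E a v i w)) \<and>
     (cond_dists_identified p X A E a (K Map.empty) \<longrightarrow>
        (\<forall>K'. intervention_kernel p X A K' \<and> distributional_consistency p X A K' \<and>
           augmented_local_markov p X A E K' \<and> K' Map.empty = K Map.empty \<and>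
           cond_dists_identified p X A E a (K' Map.empty) \<longrightarrow>
           K' (do_regime A a) = K (do_regime A a)) \<and>
        markov_property p X A (remove_outgoing (Var ` A) (augmented_dag A E))
          (K (do_regime A a)))"
proof -
  interpret causal_kernel p E A X K by unfold_locales (fact assms)+
  have "K' (do_regime A a) = K (do_regime A a)"
    if "intervention_kernel p X A K'" "distributional_consistency p X A K'"
      "augmented_local_markov p X A E K'" "K' Map.empty = K Map.empty"
      "cond_dists_identified p X A E a (K Map.empty)" for K'
  proof -
    have "causal_kernel p E A X K'" using that dag targets by unfold_locales
    with causal_kernel_axioms show ?thesis using that(4,5) a by (rule interv_identified)
  qed
  then show ?thesis
    using interv_cond_eq_obs_cond[OF a] interv_markov_property[OF a] by blast
qed

end
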